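(* Let $d$ be a well-defined derivation under the rollback semantics $\hookrightarrow$. Then, for each step $S \hookrightarrow S'$ in $d$, we have either $sta(S) \rightarrowtail^{=} sta(S')$ or $rev(S) \rightleftharpoons^{=} rev(S')$, where $\rightarrowtail$ is the standard semantics, $\rightleftharpoons$ is the (uncontrolled) reversible semantics, $sta$ and $rev$ are the projections of rollback systems to standard and reversible systems, and $R^{=}$ denotes the reflexive closure of a binary relation $R$.
   Context: **Local semantics.** Processes have pids $p$ (unique in a running system) and local states $s$ (typically an environment and an expression to be evaluated); $v$ are message values, $\ell$ message tags, $\tau$ checkpoint identifiers. The local semantics, a labeled relation on states, is left unspecified except for its labels: steps $s\xrightarrow{a}s'$ have $a$ of the form $\mathsf{seq}$, $\mathsf{send}(p',v)$, $\mathsf{rec}(\kappa,cs)$, $\mathsf{spawn}(\kappa,s_0)$, $\mathsf{check}(\kappa)$, $\mathsf{commit}(\tau)$, $\mathsf{rollback}(\tau)$. Here $\kappa$ is a special variable (a future) in $s'$ and $s'[\kappa\leftarrow x]$ is $s'$ with $\kappa$ bound to $x$; $cs$ are the clauses of a receive statement, and $\mathsf{matchrec}(cs,v)=cs_i$ means that $cs_i$ is the clause selected for message $v$. For the three rollback operators, with $\theta$ an environment: $\theta,\mathsf{check}\xrightarrow{\mathsf{check}(\kappa)}\theta,\kappa$; $\;\theta,\mathsf{commit}(\tau)\xrightarrow{\mathsf{commit}(\tau)}\theta,ok$; $\;\theta,\mathsf{rollback}(\tau)\xrightarrow{\mathsf{rollback}(\tau)}\theta,ok$, with $ok$ a constant.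 **Systems.** In each semantics a system is a parallel composition (written $|$, commutative and associative, systems being equal up to these laws) of process configurations and floating messages. Each semantics has a rule *Par*: from a step $S_1\to S_1'$ and $id(S_1')\cap id(S_2)=\emptyset$ infer $S_1|S_2\to S_1'|S_2$ with the same label. Here $id(S)$ is the set of pids in $S$ (for the rollback semantics: of pids, message tags and checkpoints in $S$), the condition serving to ensure that new identifiers are fresh in the complete system; for the backward reversible relation $\leftharpoondown$, Par has no such condition. **Standard semantics $\rightarrowtail$.** Processes $\langle p,s\rangle$, messages $(p,p',v)$ (sender, receiver, value). Rules: - if $s\xrightarrow{\mathsf{seq}}s'$: $\langle p,s\rangle\rightarrowtail\langle p,s'\rangle$; - if $s\xrightarrow{\mathsf{send}(p',v)}s'$: $\langle p,s\rangle\rightarrowtail(p,p',v)\,|\,\langle p,s'\rangle$; - if $s\xrightarrow{\mathsf{rec}(\kappa,cs)}s'$ and $\mathsf{matchrec}(cs,v)=cs_i$: $(p',p,v)\,|\,\langle p,s\rangle\rightarrowtail\langle p,s'[\kappa\leftarrow cs_i]\rangle$; - if $s\xrightarrow{\mathsf{spawn}(\kappa,s_0)}s'$ and $p'$ is a fresh pid: $\langle p,s\rangle\rightarrowtail\langle p,s'[\kappa\leftarrow p']\rangle\,|\,\langle p',s_0\rangle$. **Reversible semantics.** Processes $(h,\langle p,s\rangle)$ with $h$ a list (history; $[\,]$ empty, $x\!:\!h$ cons), messages $(p,p',\{\ell,v\})$. Forward rules ($\rightharpoonup$): - if $s\xrightarrow{\mathsf{seq}}s'$: $(h,\langle p,s\rangle)\rightharpoonup(\mathsf{seq}(s)\!:\!h,\langle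 p,s'\rangle)$; - if $s\xrightarrow{\mathsf{send}(p',v)}s'$, $\ell$ fresh: $(h,\langle p,s\rangle)\rightharpoonup(p,p',\{\ell,v\})\,|\,(\mathsf{send}(s,p',\ell)\!:\!h,\langle p,s'\rangle)$; - if $s\xrightarrow{\mathsf{rec}(\kappa,cs)}s'$, $\mathsf{matchrec}(cs,v)=cs_i$: $(p',p,\{\ell,v\})\,|\,(h,\langle p,s\rangle)\rightharpoonup(\mathsf{rec}(s,p',\ell,v)\!:\!h,\langle p,s'[\kappa\leftarrow cs_i]\rangle)$; - if $s\xrightarrow{\mathsf{spawn}(\kappa,s_0)}s'$, $p'$ a fresh pid: $(h,\langle p,s\rangle)\rightharpoonup(\mathsf{spawn}(s,p')\!:\!h,\langle p,s'[\kappa\leftarrow p']\rangle)\,|\,([\,],\langle p',s_0\rangle)$. Backward rules ($\leftharpoondown$, read from left to right): - $(\mathsf{seq}(s)\!:\!h,\langle p,s'\rangle)\leftharpoondown(h,\langle p,s\rangle)$; - $(p,p',\{\ell,v\})\,|\,(\mathsf{send}(s,p',\ell)\!:\!h,\langle p,s'\rangle)\leftharpoondown(h,\langle p,s\rangle)$; - $(\mathsf{rec}(s,p',\ell,v)\!:\!h,\langle p,s'\rangle)\leftharpoondown(p',p,\{\ell,v\})\,|\,(h,\langle p,s\rangle)$; - $(\mathsf{spawn}(s,p')\!:\!h,\langle p,s'\rangle)\,|\,([\,],\langle p',s_0\rangle)\leftharpoondown(h,\langle p,s\rangle)$. $\rightleftharpoons$ is the union $\rightharpoonup\cup\leftharpoondown$.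 **Rollback semantics $\hookrightarrow$.** Process configurations are forward, $(C,D,h,\langle p,s\rangle)$, or backward, $(\!(C,D,h,\langle p,s\rangle)\!)^\tau$ ($\tau$ being the target of a rollback request); $C$ is a set of (active) checkpoint identifiers, $D$ a set of delayed commits $\langle\tau,h,P\rangle$ ($P$ a set of pids), $h$ a history, i.e. a list of terms $\mathsf{seq}(s)$, $\mathsf{send}(s,p',\ell)$, $\mathsf{rec}(C'',C',s,p',\ell,v)$, $\mathsf{spawn}(s,p')$, $\mathsf{check}(\tau,s)$, $\mathsf{commit}(\tau,s)$. Messages are $(C,p,p',\{\ell,v\})$. Auxiliary notions: $\mathsf{add}_C(a,h)=h$ if $C=\emptyset$, and $a\!:\!h$ otherwise; $last_\tau(h)$ is true iff the last (most recent) $\mathsf{check}$ or $\mathsf{rec}$ term in $h$ has the form $\mathsf{check}(\tau,s')$ or $\mathsf{rec}(C',\ldots)$ with $\tau\in C'$ (first argument); $dp_\tau(h)$ is the set of pids $p$ such that some $\mathsf{spawn}(s,p)$ or $\mathsf{send}(s,p,\ell)$ occurs in $h$. $propagate(\tau,P)$ always returns true and has this side effect: for each $p'\in P$, look for the process $(C',D',h',\langle p',s'\rangle)$ with pid $p'$; if $\tau\notin C'$ nothing is done, otherwise $\tau$ is removed from $C'$ and $propagate(\tau,dp_\tau(h'))$ is called. Forward rules (together with Par): - *Seq*: if $s\xrightarrow{\mathsf{seq}}s'$: $(C,D,h,\langle p,s\rangle)\hookrightarrow_{p,\underline{\mathsf{seq}}}(C,D,\mathsf{add}_C(\mathsf{seq}(s),h),\langle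 p,s'\rangle)$; - *Send*: if $s\xrightarrow{\mathsf{send}(p',v)}s'$, $\ell$ fresh: $(C,D,h,\langle p,s\rangle)\hookrightarrow_{p,\underline{\mathsf{send}}(\ell)}(C,p,p',\{\ell,v\})\,|\,(C,D,\mathsf{add}_C(\mathsf{send}(s,p',\ell),h),\langle p,s'\rangle)$; - *Receive*: if $s\xrightarrow{\mathsf{rec}(\kappa,cs)}s'$, $\mathsf{matchrec}(cs,v)=cs_i$: $(C',p',p,\{\ell,v\})\,|\,(C,D,h,\langle p,s\rangle)\hookrightarrow_{p,\underline{\mathsf{rec}}(\ell)}(C\cup C',D,h',\langle p,s'[\kappa\leftarrow cs_i]\rangle)$ with $h'=\mathsf{add}_{C}(\mathsf{rec}(C'\setminus C,C',s,p',\ell,v),h)$; - *Spawn*: if $s\xrightarrow{\mathsf{spawn}(\kappa,s_0)}s'$, $p'$ a fresh pid: $(C,D,h,\langle p,s\rangle)\hookrightarrow_{p,\underline{\mathsf{spawn}}(p')}(C,D,\mathsf{add}_C(\mathsf{spawn}(s,p'),h),\langle p,s'[\kappa\leftarrow p']\rangle)\,|\,(C,\emptyset,[\,],\langle p',s_0\rangle)$; - *Check*: if $s\xrightarrow{\mathsf{check}(\kappa)}s'$, $\tau$ a fresh identifier: $(C,D,h,\langle p,s\rangle)\hookrightarrow_{p,\underline{\mathsf{check}}(\tau)}(C\cup\{\tau\},D,\mathsf{check}(\tau,s)\!:\!h,\langle p,s'[\kappa\leftarrow\tau]\rangle)$; - *Commit*: if $s\xrightarrow{\mathsf{commit}(\tau)}s'$,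 $last_\tau(h)$ is true, $dp_\tau(h)=P$ and $propagate(\tau,P)$: $(C,D,h,\langle p,s\rangle)\hookrightarrow_{p,\underline{\mathsf{commit}}(\tau)}(C\setminus\{\tau\},D,\mathsf{commit}(\tau,s)\!:\!h,\langle p,s'\rangle)$; if instead $last_\tau(h)$ is false and $dp_\tau(h)=P$: $(C,D,h,\langle p,s\rangle)\hookrightarrow_{p,\underline{\mathsf{delay}}(\tau)}(C\setminus\{\tau\},D\cup\{\langle\tau,h,P\rangle\},\mathsf{commit}(\tau,s)\!:\!h,\langle p,s'\rangle)$; - *Delay*: if $last_\tau(h')$ is true and $propagate(\tau,P)$: $(C,D\cup\{\langle\tau,h',P\rangle\},h,\langle p,s\rangle)\hookrightarrow(C,D,h,\langle p,s\rangle)$; - *Rollback*: if $s\xrightarrow{\mathsf{rollback}(\tau)}s'$: $(C,D,h,\langle p,s\rangle)\hookrightarrow_{p,\underline{\mathsf{rollback}}(\tau)}(\!(C,D,h,\langle p,s'\rangle)\!)^\tau$. Backward rules (all under the side condition that $\tau$ is in the set of active checkpoints of the backward process $p$): - $\overline{Seq}$: $(\!(C,D,\mathsf{seq}(s)\!:\!h,\langle p,s'\rangle)\!)^\tau\hookrightarrow_{p,\overline{\mathsf{seq}}}(\!(C,D,h,\langle p,s\rangle)\!)^\tau$; - $\overline{Send}$ (1): $(C,p,p',\{\ell,v\})\,|\,(\!(C,D,\mathsf{send}(s,p',\ell)\!:\!h,\langle p,s'\rangle)\!)^\tau\hookrightarrow_{p,\overline{\mathsf{send}}(\ell)}(\!(C,D,h,\langle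 p,s\rangle)\!)^\tau$; - $\overline{Send}$ (2), only when the message tagged $\ell$ has been received by $p'$ according to $h'$: $(\!(C,D,\mathsf{send}(s,p',\ell)\!:\!h,\langle p,s'\rangle)\!)^\tau\,|\,(C',D',h',\langle p',s''\rangle)\hookrightarrow(\!(C,D,\mathsf{send}(s,p',\ell)\!:\!h,\langle p,s'\rangle)\!)^\tau\,|\,(\!(C',D',h',\langle p',s''\rangle)\!)^\tau$; - $\overline{Receive}$: $(\!(C\cup C',D,\mathsf{rec}(C'',C',s,p',\ell,v)\!:\!h,\langle p,s'\rangle)\!)^\tau\hookrightarrow_{p,\overline{\mathsf{rec}}(\ell)}(C',p',p,\{\ell,v\})\,|\,Q$, with $Q=(C,D,h,\langle p,s\rangle)$ if $\tau\in C''$ and $Q=(\!(C,D,h,\langle p,s\rangle)\!)^\tau$ if $\tau\notin C''$; - $\overline{Spawn}$ (1): $(\!(C,D,\mathsf{spawn}(s,p')\!:\!h,\langle p,s'\rangle)\!)^\tau\,|\,(\!(C,\emptyset,[\,],\langle p',s_0\rangle)\!)^\tau\hookrightarrow_{p,\overline{\mathsf{spawn}}(p')}(\!(C,D,h,\langle p,s\rangle)\!)^\tau$; - $\overline{Spawn}$ (2): $(\!(C,D,\mathsf{spawn}(s,p')\!:\!h,\langle p,s'\rangle)\!)^\tau\,|\,(C',D',h',\langle p',s''\rangle)\hookrightarrow(\!(C,D,\mathsf{spawn}(s,p')\!:\!h,\langle p,s'\rangle)\!)^\tau\,|\,(\!(C',D',h',\langle p',s''\rangle)\!)^\tau$; -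 $\overline{Check}$: $(\!(C,D,\mathsf{check}(\tau,s)\!:\!h,\langle p,s'\rangle)\!)^\tau\hookrightarrow_{p,\overline{\mathsf{check}}(\tau)}(C\setminus\{\tau\},D,h,\langle p,s\rangle)$; and, for $\tau'\neq\tau$, $(\!(C,D,\mathsf{check}(\tau',s)\!:\!h,\langle p,s'\rangle)\!)^\tau\hookrightarrow_{p,\overline{\mathsf{check}}(\tau')}(\!(C\setminus\{\tau'\},D,h,\langle p,s\rangle)\!)^\tau$; - $\overline{Commit}$: if $D$ has no element of the form $\langle\tau',\_,\_\rangle$: $(\!(C,D,\mathsf{commit}(\tau',s)\!:\!h,\langle p,s'\rangle)\!)^\tau\hookrightarrow_{p,\overline{\mathsf{commit}}(\tau')}(\!(C\cup\{\tau'\},D,h,\langle p,s\rangle)\!)^\tau$; and $(\!(C,D\cup\{\langle\tau',h',P\rangle\},\mathsf{commit}(\tau',s)\!:\!h,\langle p,s'\rangle)\!)^\tau\hookrightarrow_{p,\overline{\mathsf{commit}}(\tau')}(\!(C\cup\{\tau'\},D,h,\langle p,s\rangle)\!)^\tau$. Conventions: $\overline{Send}$ has higher priority than $\overline{Receive}$, so that once a message is put back into the system its sending is undone rather than the message being received again; the selection strategy for processes is fair. **Well-defined derivations.** A system is reachable if it is obtained by $\hookrightarrow^*$ from $(\emptyset,\emptyset,[\,],\langle p,s\rangle)$ for some pid $p$ and state $s$. Informally, in well-defined derivations $\mathsf{commit}(\tau)$ and $\mathsf{rollback}(\tau)$ are called only by the process that created the checkpoint $\tau$, every such call is preceded by a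 call to $\mathsf{check}$ returning $\tau$, and a process has only one action for every checkpoint $\tau$, either $\mathsf{commit}(\tau)$ or $\mathsf{rollback}(\tau)$, but not both (a commit undone by a rollback to a different checkpoint is removed from the history and no longer counts). Formally, $d=(S_0\hookrightarrow S_1\hookrightarrow\cdots\hookrightarrow S_n)$ is well-defined if: (1) $S_0$ is reachable; (2) every step $S_i\hookrightarrow_{p,\underline{\mathsf{commit}}(\tau)}S_{i+1}$ in $d$ is preceded by a step $S_j\hookrightarrow_{p,\underline{\mathsf{check}}(\tau)}S_{j+1}$, $j<i$; (3) every step $S_i\hookrightarrow_{p,\underline{\mathsf{rollback}}(\tau)}S_{i+1}$ in $d$ is preceded by a step $S_j\hookrightarrow_{p,\underline{\mathsf{check}}(\tau)}S_{j+1}$, $j<i$; (4) no process history in $d$ may have both $\mathsf{commit}(\tau)$ and $\mathsf{rollback}(\tau)$ at the same time. **Projections.** For a state $s$, $\overline{s}$ is $s$ with all occurrences of the rollback operators ($\mathsf{check}$, $\mathsf{commit}$, $\mathsf{rollback}$) and of checkpoint identifiers (if any) replaced by an arbitrary constant $ok$. $sta$ and $rev$ act componentwise on parallel compositions: $sta$ maps both $(C,D,h,\langle p,s\rangle)$ and $(\!(C,D,h,\langle p,s\rangle)\!)^\tau$ to $\langle p,\overline{s}\rangle$, and $(C,p,p',\{\ell,v\})$ to $(p,p',v)$; $rev$ maps both $(C,D,h,\langle p,s\rangle)$ and $(\!(C,D,h,\langle p,s\rangle)\!)^\tau$ to $(r(h),\langle p,\overline{s}\rangle)$, and $(C,p,p',\{\ell,v\})$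 to $(p,p',\{\ell,v\})$. Here $r$ acts on histories element by element (with $r([\,])=[\,]$): it keeps $\mathsf{seq}(s)$, $\mathsf{send}(s,p',\ell)$ and $\mathsf{spawn}(s,p')$ unchanged, replaces $\mathsf{rec}(C,C',s,p',\ell,v)$ by $\mathsf{rec}(s,p',\ell,v)$, and deletes $\mathsf{check}(\tau,s)$ and $\mathsf{commit}(\tau,s)$.
   Formalization: Receive records unless C∪C' is empty; its undo needs C''=C'\C; rev overlines history states; overlining must respect local steps; Par tests only new tags/checkpoints; the run to S0 is well-defined too; commit (also delayed) or rollback of τ needs check(τ), no commit(τ), in p's history. *)

theory Defs
  imports "HOL-Library.Multiset"
begin

section \<open>Local semantics\<close>

text \<open>Type variables used throughout: \<open>'s\<close> local states, \<open>'p\<close> pids, \<open>'v\<close> message values,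
  \<open>'l\<close> message tags, \<open>'c\<close> checkpoint identifiers, \<open>'k\<close> futures, \<open>'cl\<close> clauses of receive
  statements.\<close>

datatype ('s, 'p, 'v, 'c, 'k, 'cl) lab =
    LSeq
  | LSend 'p 'v
  | LRec 'k "'cl list"
  | LSpawn 'k 's
  | LCheck 'k
  | LCommit 'c
  | LRollback 'c

text \<open>What a future can be bound to.\<close>

datatype ('p, 'c, 'cl) bval = BClause 'cl | BPid 'p | BCkpt 'c

text \<open>\<open>lstep s a s'\<close> is the labelled transition relation on local states, \<open>bind s k x\<close> is the
  state \<open>s\<close> with its future \<open>k\<close> bound to \<open>x\<close>, and \<open>matchrec cs v = Some c\<close> says that \<open>c\<close> is the
  clause of \<open>cs\<close> selected for the message value \<open>v\<close>.  All three are arbitrary.\<close>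

locale local_semantics =
  fixes lstep :: "'s \<Rightarrow> ('s, 'p, 'v, 'c, 'k, 'cl) lab \<Rightarrow> 's \<Rightarrow> bool"
    and bind :: "'s \<Rightarrow> 'k \<Rightarrow> ('p, 'c, 'cl) bval \<Rightarrow> 's"
    and matchrec :: "'cl list \<Rightarrow> 'v \<Rightarrow> 'cl option"

text \<open>The map \<open>ovl\<close> (overlining) replaces the rollback operators and the checkpoint identifiers in
  a state by the constant \<open>ok\<close>; \<open>ovlc\<close> does the same in a clause.  Since the syntax of states is
  left open, the maps are described by what this replacement does to local steps.  A check, commit
  or rollback step only turns an operator into \<open>ok\<close> or into a checkpoint identifier, so it becomes
  invisible; every other step is insensitive to the replacement.  A sequential step may become
  invisible as well, if it takes place inside the argument of a rollback operator.  Message values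
  carry no checkpoint identifiers.\<close>

locale overlining = local_semantics lstep bind matchrec
  for lstep :: "'s \<Rightarrow> ('s, 'p, 'v, 'c, 'k, 'cl) lab \<Rightarrow> 's \<Rightarrow> bool"
    and bind :: "'s \<Rightarrow> 'k \<Rightarrow> ('p, 'c, 'cl) bval \<Rightarrow> 's"
    and matchrec :: "'cl list \<Rightarrow> 'v \<Rightarrow> 'cl option" +
  fixes ovl :: "'s \<Rightarrow> 's"
    and ovlc :: "'cl \<Rightarrow> 'cl"
  assumes ovl_seq:
      "lstep s LSeq s' \<Longrightarrow> lstep (ovl s) LSeq (ovl s') \<or> ovl s' = ovl s"
    and ovl_send:
      "lstep s (LSend q v) s' \<Longrightarrow> lstep (ovl s) (LSend q v) (ovl s')"
    and ovl_rec:
      "lstep s (LRec k cs) s' \<Longrightarrow> lstep (ovl s) (LRec k (map ovlc cs)) (ovl s')"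
    and ovl_matchrec:
      "matchrec cs v = Some c \<Longrightarrow> matchrec (map ovlc cs) v = Some (ovlc c)"
    and ovl_spawn:
      "lstep s (LSpawn k s0) s' \<Longrightarrow> lstep (ovl s) (LSpawn k (ovl s0)) (ovl s')"
    and ovl_bind_clause:
      "ovl (bind s k (BClause c)) = bind (ovl s) k (BClause (ovlc c))"
    and ovl_bind_pid:
      "ovl (bind s k (BPid q)) = bind (ovl s) k (BPid q)"
    and ovl_check:
      "lstep s (LCheck k) s' \<Longrightarrow> ovl (bind s' k (BCkpt \<tau>)) = ovl s"
    and ovl_commit:
      "lstep s (LCommit \<tau>) s' \<Longrightarrow> ovl s' = ovl s"
    and ovl_rollback:
      "lstep s (LRollback \<tau>) s' \<Longrightarrow> ovl s' = ovl s"


section \<open>Standard semantics\<close>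

text \<open>In all three semantics a system is a finite multiset of components, and parallel composition
  is multiset union.\<close>

datatype ('s, 'p, 'v) scomp =
    SProc 'p 's
  | SMsg 'p 'p 'v

text \<open>In the Par rules the pids of a system are those of its processes; pids that are merely
  mentioned (for instance as the receiver of a message) do not count.\<close>

primrec spid :: "('s, 'p, 'v) scomp \<Rightarrow> 'p set" where
  "spid (SProc p s) = {p}"
| "spid (SMsg p q v) = {}"

definition spids :: "('s, 'p, 'v) scomp multiset \<Rightarrow> 'p set" where
  "spids S = (\<Union>x\<in>set_mset S. spid x)"

context local_semantics
begin

inductive std_step :: "('s, 'p, 'v) scomp multiset \<Rightarrow> ('s, 'p, 'v) scomp multiset \<Rightarrow> bool" where
  std_seq:
    "lstep s LSeq s' \<Longrightarrow> std_step {#SProc p s#} {#SProc p s'#}"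
| std_send:
    "lstep s (LSend p' v) s' \<Longrightarrow> std_step {#SProc p s#} {#SMsg p p' v, SProc p s'#}"
| std_rec:
    "lstep s (LRec k cs) s' \<Longrightarrow> matchrec cs v = Some c \<Longrightarrow>
     std_step {#SMsg p' p v, SProc p s#} {#SProc p (bind s' k (BClause c))#}"
| std_spawn:
    "lstep s (LSpawn k s0) s' \<Longrightarrow> p' \<noteq> p \<Longrightarrow>
     std_step {#SProc p s#} {#SProc p (bind s' k (BPid p')), SProc p' s0#}"
| std_par:
    "std_step S1 S1' \<Longrightarrow> spids S1' \<inter> spids S2 = {} \<Longrightarrow> std_step (S1 + S2) (S1' + S2)"

end


section \<open>Reversible semantics\<close>

datatype ('s, 'p, 'v, 'l) ritem =
    RSeq 's
  | RSend 's 'p 'l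
  | RRec 's 'p 'l 'v
  | RSpawn 's 'p

datatype ('s, 'p, 'v, 'l) rcomp =
    RProc "('s, 'p, 'v, 'l) ritem list" 'p 's
  | RMsg 'p 'p 'l 'v

primrec rpid :: "('s, 'p, 'v, 'l) rcomp \<Rightarrow> 'p set" where
  "rpid (RProc h p s) = {p}"
| "rpid (RMsg p q l v) = {}"

definition rpids :: "('s, 'p, 'v, 'l) rcomp multiset \<Rightarrow> 'p set" where
  "rpids S = (\<Union>x\<in>set_mset S. rpid x)"

primrec ritem_tags :: "('s, 'p, 'v, 'l) ritem \<Rightarrow> 'l set" where
  "ritem_tags (RSeq s) = {}"
| "ritem_tags (RSend s p l) = {l}"
| "ritem_tags (RRec s p l v) = {l}"
| "ritem_tags (RSpawn s p) = {}"

primrec rcomp_tags :: "('s, 'p, 'v, 'l) rcomp \<Rightarrow> 'l set" where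
  "rcomp_tags (RProc h p s) = (\<Union>i\<in>set h. ritem_tags i)"
| "rcomp_tags (RMsg p q l v) = {l}"

definition rtags :: "('s, 'p, 'v, 'l) rcomp multiset \<Rightarrow> 'l set" where
  "rtags S = (\<Union>x\<in>set_mset S. rcomp_tags x)"

context local_semantics
begin

text \<open>A tag legitimately occurs in several components (in a message, or in the histories of its
  sender and its receiver), so Par asks only the tags introduced by the step to be fresh.\<close>

inductive rev_fwd :: "('s, 'p, 'v, 'l) rcomp multiset \<Rightarrow> ('s, 'p, 'v, 'l) rcomp multiset \<Rightarrow> bool"
where
  rf_seq:
    "lstep s LSeq s' \<Longrightarrow> rev_fwd {#RProc h p s#} {#RProc (RSeq s # h) p s'#}"
| rf_send:
    "lstep s (LSend p' v) s' \<Longrightarrow> l \<notin> rtags {#RProc h p s#} \<Longrightarrow>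
     rev_fwd {#RProc h p s#} {#RMsg p p' l v, RProc (RSend s p' l # h) p s'#}"
| rf_rec:
    "lstep s (LRec k cs) s' \<Longrightarrow> matchrec cs v = Some c \<Longrightarrow>
     rev_fwd {#RMsg p' p l v, RProc h p s#}
       {#RProc (RRec s p' l v # h) p (bind s' k (BClause c))#}"
| rf_spawn:
    "lstep s (LSpawn k s0) s' \<Longrightarrow> p' \<noteq> p \<Longrightarrow>
     rev_fwd {#RProc h p s#}
       {#RProc (RSpawn s p' # h) p (bind s' k (BPid p')), RProc [] p' s0#}"
| rf_par:
    "rev_fwd S1 S1' \<Longrightarrow> rpids S1' \<inter> rpids S2 = {} \<Longrightarrow> (rtags S1' - rtags S1) \<inter> rtags S2 = {} \<Longrightarrow>
     rev_fwd (S1 + S2) (S1' + S2)"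

end

inductive rev_bwd :: "('s, 'p, 'v, 'l) rcomp multiset \<Rightarrow> ('s, 'p, 'v, 'l) rcomp multiset \<Rightarrow> bool"
where
  rb_seq:
    "rev_bwd {#RProc (RSeq s # h) p s'#} {#RProc h p s#}"
| rb_send:
    "rev_bwd {#RMsg p p' l v, RProc (RSend s p' l # h) p s'#} {#RProc h p s#}"
| rb_rec:
    "rev_bwd {#RProc (RRec s p' l v # h) p s'#} {#RMsg p' p l v, RProc h p s#}"
| rb_spawn:
    "rev_bwd {#RProc (RSpawn s p' # h) p s', RProc [] p' s0#} {#RProc h p s#}"
| rb_par:
    "rev_bwd S1 S1' \<Longrightarrow> rev_bwd (S1 + S2) (S1' + S2)"

definition (in local_semantics) rev_step ::
    "('s, 'p, 'v, 'l) rcomp multiset \<Rightarrow> ('s, 'p, 'v, 'l) rcomp multiset \<Rightarrow> bool" where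
  "rev_step S S' \<longleftrightarrow> rev_fwd S S' \<or> rev_bwd S S'"


section \<open>Rollback semantics\<close>

datatype ('s, 'p, 'v, 'l, 'c) hitem =
    HSeq 's
  | HSend 's 'p 'l
  | HRec "'c set" "'c set" 's 'p 'l 'v
  | HSpawn 's 'p
  | HCheck 'c 's
  | HCommit 'c 's

type_synonym ('s, 'p, 'v, 'l, 'c) hist = "('s, 'p, 'v, 'l, 'c) hitem list"

type_synonym ('s, 'p, 'v, 'l, 'c) delayed = "('c \<times> ('s, 'p, 'v, 'l, 'c) hist \<times> 'p set) set"

text \<open>\<open>Fwd C D h p s\<close> is a forward process and \<open>Bwd \<tau> C D h p s\<close> a backward one with target \<open>\<tau>\<close>.\<close>

datatype ('s, 'p, 'v, 'l, 'c) comp =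
    Fwd "'c set" "('s, 'p, 'v, 'l, 'c) delayed" "('s, 'p, 'v, 'l, 'c) hist" 'p 's
  | Bwd 'c "'c set" "('s, 'p, 'v, 'l, 'c) delayed" "('s, 'p, 'v, 'l, 'c) hist" 'p 's
  | Msg "'c set" 'p 'p 'l 'v

type_synonym ('s, 'p, 'v, 'l, 'c) sys = "('s, 'p, 'v, 'l, 'c) comp multiset"

datatype ('p, 'l, 'c) act =
    ASeq | ASend 'l | ARec 'l | ASpawn 'p | ACheck 'c | ACommit 'c | ADelay 'c | ARollback 'c
  | USeq | USend 'l | URec 'l | USpawn 'p | UCheck 'c | UCommit 'c

text \<open>The label of a rollback step; \<open>None\<close> for the steps without label.\<close>

type_synonym ('p, 'l, 'c) rlab = "('p \<times> ('p, 'l, 'c) act) option"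

definition add :: "'c set \<Rightarrow> 'i \<Rightarrow> 'i list \<Rightarrow> 'i list" where
  "add C a h = (if C = {} then h else a # h)"

fun last_ck :: "'c \<Rightarrow> ('s, 'p, 'v, 'l, 'c) hist \<Rightarrow> bool" where
  "last_ck \<tau> [] \<longleftrightarrow> False"
| "last_ck \<tau> (HCheck \<tau>' s # h) \<longleftrightarrow> \<tau>' = \<tau>"
| "last_ck \<tau> (HRec C'' C' s p l v # h) \<longleftrightarrow> \<tau> \<in> C''"
| "last_ck \<tau> (_ # h) \<longleftrightarrow> last_ck \<tau> h"

definition dp :: "('s, 'p, 'v, 'l, 'c) hist \<Rightarrow> 'p set" where
  "dp h = {p. (\<exists>s. HSpawn s p \<in> set h) \<or> (\<exists>s l. HSend s p l \<in> set h)}"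

text \<open>\<open>reached \<tau> S P\<close> are the pids on which the recursive calls started by propagating \<open>\<tau>\<close> to \<open>P\<close>
  in the complete system \<open>S\<close> remove \<open>\<tau>\<close> (a second visit of a process finds \<open>\<tau>\<close> removed and does
  nothing), and \<open>propagate \<tau> P S\<close> is \<open>S\<close> after these side effects.\<close>

inductive_set reached :: "'c \<Rightarrow> ('s, 'p, 'v, 'l, 'c) sys \<Rightarrow> 'p set \<Rightarrow> 'p set"
  for \<tau> S P where
  "q \<in> P \<Longrightarrow> Fwd C D h q s \<in># S \<Longrightarrow> \<tau> \<in> C \<Longrightarrow> q \<in> reached \<tau> S P"
| "p \<in> reached \<tau> S P \<Longrightarrow> Fwd C0 D0 h0 p s0 \<in># S \<Longrightarrow> \<tau> \<in> C0 \<Longrightarrow> q \<in> dp h0 \<Longrightarrow>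
   Fwd C D h q s \<in># S \<Longrightarrow> \<tau> \<in> C \<Longrightarrow> q \<in> reached \<tau> S P"

fun drop_ckpt :: "'c \<Rightarrow> 'p set \<Rightarrow> ('s, 'p, 'v, 'l, 'c) comp \<Rightarrow> ('s, 'p, 'v, 'l, 'c) comp" where
  "drop_ckpt \<tau> Q (Fwd C D h p s) = Fwd (if p \<in> Q then C - {\<tau>} else C) D h p s"
| "drop_ckpt \<tau> Q x = x"

definition propagate ::
    "'c \<Rightarrow> 'p set \<Rightarrow> ('s, 'p, 'v, 'l, 'c) sys \<Rightarrow> ('s, 'p, 'v, 'l, 'c) sys" where
  "propagate \<tau> P S = image_mset (drop_ckpt \<tau> (reached \<tau> S P)) S"

primrec pid :: "('s, 'p, 'v, 'l, 'c) comp \<Rightarrow> 'p set" where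
  "pid (Fwd C D h p s) = {p}"
| "pid (Bwd \<tau> C D h p s) = {p}"
| "pid (Msg C p q l v) = {}"

definition pids :: "('s, 'p, 'v, 'l, 'c) sys \<Rightarrow> 'p set" where
  "pids S = (\<Union>x\<in>set_mset S. pid x)"

primrec item_tags :: "('s, 'p, 'v, 'l, 'c) hitem \<Rightarrow> 'l set" where
  "item_tags (HSeq s) = {}"
| "item_tags (HSend s p l) = {l}"
| "item_tags (HRec C'' C' s p l v) = {l}"
| "item_tags (HSpawn s p) = {}"
| "item_tags (HCheck \<tau> s) = {}"
| "item_tags (HCommit \<tau> s) = {}"

primrec item_ckpts :: "('s, 'p, 'v, 'l, 'c) hitem \<Rightarrow> 'c set" where
  "item_ckpts (HSeq s) = {}"
| "item_ckpts (HSend s p l) = {}"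
| "item_ckpts (HRec C'' C' s p l v) = C'' \<union> C'"
| "item_ckpts (HSpawn s p) = {}"
| "item_ckpts (HCheck \<tau> s) = {\<tau>}"
| "item_ckpts (HCommit \<tau> s) = {\<tau>}"

definition hist_tags :: "('s, 'p, 'v, 'l, 'c) hist \<Rightarrow> 'l set" where
  "hist_tags h = (\<Union>i\<in>set h. item_tags i)"

definition hist_ckpts :: "('s, 'p, 'v, 'l, 'c) hist \<Rightarrow> 'c set" where
  "hist_ckpts h = (\<Union>i\<in>set h. item_ckpts i)"

definition delayed_tags :: "('s, 'p, 'v, 'l, 'c) delayed \<Rightarrow> 'l set" where
  "delayed_tags D = (\<Union>(\<tau>, h, P)\<in>D. hist_tags h)"

definition delayed_ckpts :: "('s, 'p, 'v, 'l, 'c) delayed \<Rightarrow> 'c set" where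
  "delayed_ckpts D = (\<Union>(\<tau>, h, P)\<in>D. insert \<tau> (hist_ckpts h))"

primrec comp_tags :: "('s, 'p, 'v, 'l, 'c) comp \<Rightarrow> 'l set" where
  "comp_tags (Fwd C D h p s) = delayed_tags D \<union> hist_tags h"
| "comp_tags (Bwd \<tau> C D h p s) = delayed_tags D \<union> hist_tags h"
| "comp_tags (Msg C p q l v) = {l}"

primrec comp_ckpts :: "('s, 'p, 'v, 'l, 'c) comp \<Rightarrow> 'c set" where
  "comp_ckpts (Fwd C D h p s) = C \<union> delayed_ckpts D \<union> hist_ckpts h"
| "comp_ckpts (Bwd \<tau> C D h p s) = insert \<tau> (C \<union> delayed_ckpts D \<union> hist_ckpts h)"
| "comp_ckpts (Msg C p q l v) = C"

definition tags :: "('s, 'p, 'v, 'l, 'c) sys \<Rightarrow> 'l set" where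
  "tags S = (\<Union>x\<in>set_mset S. comp_tags x)"

definition ckpts :: "('s, 'p, 'v, 'l, 'c) sys \<Rightarrow> 'c set" where
  "ckpts S = (\<Union>x\<in>set_mset S. comp_ckpts x)"

context local_semantics
begin

text \<open>The rules closed under Par.  Tags and checkpoints are shared between components (a checkpoint
  belongs to the sets of all processes depending on it), so Par asks only those introduced by the
  step to be fresh.

  A process without active checkpoints that receives a message carrying some records this step,
  since it is what a rollback to those checkpoints has to undo; hence the index of \<open>add\<close> in
  \<open>roll_receive\<close> is the set of checkpoints active after the step.

  In \<open>roll_u_receive\<close> the set \<open>C\<close> is the one active before the undone receive: the equation relating
  it to the record is the one established by \<open>roll_receive\<close>, and it picks out \<open>C\<close> among the sets
  whose union with \<open>C'\<close> is the current one.\<close>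

inductive roll_local ::
    "('s, 'p, 'v, 'l, 'c) sys \<Rightarrow> ('p, 'l, 'c) rlab \<Rightarrow> ('s, 'p, 'v, 'l, 'c) sys \<Rightarrow> bool"
where
  roll_seq:
    "lstep s LSeq s' \<Longrightarrow>
     roll_local {#Fwd C D h p s#} (Some (p, ASeq)) {#Fwd C D (add C (HSeq s) h) p s'#}"
| roll_send:
    "lstep s (LSend p' v) s' \<Longrightarrow> l \<notin> tags {#Fwd C D h p s#} \<Longrightarrow>
     roll_local {#Fwd C D h p s#} (Some (p, ASend l))
       {#Msg C p p' l v, Fwd C D (add C (HSend s p' l) h) p s'#}"
| roll_receive:
    "lstep s (LRec k cs) s' \<Longrightarrow> matchrec cs v = Some c \<Longrightarrow>
     roll_local {#Msg C' p' p l v, Fwd C D h p s#} (Some (p, ARec l))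
       {#Fwd (C \<union> C') D (add (C \<union> C') (HRec (C' - C) C' s p' l v) h) p (bind s' k (BClause c))#}"
| roll_spawn:
    "lstep s (LSpawn k s0) s' \<Longrightarrow> p' \<noteq> p \<Longrightarrow>
     roll_local {#Fwd C D h p s#} (Some (p, ASpawn p'))
       {#Fwd C D (add C (HSpawn s p') h) p (bind s' k (BPid p')), Fwd C {} [] p' s0#}"
| roll_check:
    "lstep s (LCheck k) s' \<Longrightarrow> \<tau> \<notin> ckpts {#Fwd C D h p s#} \<Longrightarrow>
     roll_local {#Fwd C D h p s#} (Some (p, ACheck \<tau>))
       {#Fwd (C \<union> {\<tau>}) D (HCheck \<tau> s # h) p (bind s' k (BCkpt \<tau>))#}"
| roll_rollback:
    "lstep s (LRollback \<tau>) s' \<Longrightarrow>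
     roll_local {#Fwd C D h p s#} (Some (p, ARollback \<tau>)) {#Bwd \<tau> C D h p s'#}"
| roll_u_seq:
    "\<tau> \<in> C \<Longrightarrow>
     roll_local {#Bwd \<tau> C D (HSeq s # h) p s'#} (Some (p, USeq)) {#Bwd \<tau> C D h p s#}"
| roll_u_send1:
    "\<tau> \<in> C \<Longrightarrow>
     roll_local {#Msg C p p' l v, Bwd \<tau> C D (HSend s p' l # h) p s'#} (Some (p, USend l))
       {#Bwd \<tau> C D h p s#}"
| roll_u_send2:
    "\<tau> \<in> C \<Longrightarrow> HRec C1 C2 s1 p l v \<in> set h' \<Longrightarrow>
     roll_local {#Bwd \<tau> C D (HSend s p' l # h) p s', Fwd C' D' h' p' s''#} None
       {#Bwd \<tau> C D (HSend s p' l # h) p s', Bwd \<tau> C' D' h' p' s''#}"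
| roll_u_receive:
    "\<tau> \<in> C \<union> C' \<Longrightarrow> C'' = C' - C \<Longrightarrow>
     roll_local {#Bwd \<tau> (C \<union> C') D (HRec C'' C' s p' l v # h) p s'#} (Some (p, URec l))
       {#Msg C' p' p l v, if \<tau> \<in> C'' then Fwd C D h p s else Bwd \<tau> C D h p s#}"
| roll_u_spawn1:
    "\<tau> \<in> C \<Longrightarrow>
     roll_local {#Bwd \<tau> C D (HSpawn s p' # h) p s', Bwd \<tau> C {} [] p' s0#} (Some (p, USpawn p'))
       {#Bwd \<tau> C D h p s#}"
| roll_u_spawn2:
    "\<tau> \<in> C \<Longrightarrow>
     roll_local {#Bwd \<tau> C D (HSpawn s p' # h) p s', Fwd C' D' h' p' s''#} None
       {#Bwd \<tau> C D (HSpawn s p' # h) p s', Bwd \<tau> C' D' h' p' s''#}"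
| roll_u_check1:
    "\<tau> \<in> C \<Longrightarrow>
     roll_local {#Bwd \<tau> C D (HCheck \<tau> s # h) p s'#} (Some (p, UCheck \<tau>))
       {#Fwd (C - {\<tau>}) D h p s#}"
| roll_u_check2:
    "\<tau> \<in> C \<Longrightarrow> \<tau>' \<noteq> \<tau> \<Longrightarrow>
     roll_local {#Bwd \<tau> C D (HCheck \<tau>' s # h) p s'#} (Some (p, UCheck \<tau>'))
       {#Bwd \<tau> (C - {\<tau>'}) D h p s#}"
| roll_u_commit1:
    "\<tau> \<in> C \<Longrightarrow> \<not> (\<exists>h' P. (\<tau>', h', P) \<in> D) \<Longrightarrow>
     roll_local {#Bwd \<tau> C D (HCommit \<tau>' s # h) p s'#} (Some (p, UCommit \<tau>'))
       {#Bwd \<tau> (C \<union> {\<tau>'}) D h p s#}"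
| roll_u_commit2:
    "\<tau> \<in> C \<Longrightarrow>
     roll_local {#Bwd \<tau> C (D \<union> {(\<tau>', h', P)}) (HCommit \<tau>' s # h) p s'#} (Some (p, UCommit \<tau>'))
       {#Bwd \<tau> (C \<union> {\<tau>'}) D h p s#}"
| roll_par:
    "roll_local S1 a S1' \<Longrightarrow> pids S1' \<inter> pids S2 = {} \<Longrightarrow>
     (tags S1' - tags S1) \<inter> tags S2 = {} \<Longrightarrow> (ckpts S1' - ckpts S1) \<inter> ckpts S2 = {} \<Longrightarrow>
     roll_local (S1 + S2) a (S1' + S2)"

text \<open>Commits have side effects on the whole system, so they are stated with the complete
  environment \<open>M\<close> of the process instead of being closed under Par.\<close>

inductive roll_step ::
    "('s, 'p, 'v, 'l, 'c) sys \<Rightarrow> ('p, 'l, 'c) rlab \<Rightarrow> ('s, 'p, 'v, 'l, 'c) sys \<Rightarrow> bool"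
where
  roll_local:
    "roll_local S a S' \<Longrightarrow> roll_step S a S'"
| roll_commit:
    "lstep s (LCommit \<tau>) s' \<Longrightarrow> last_ck \<tau> h \<Longrightarrow>
     roll_step ({#Fwd C D h p s#} + M) (Some (p, ACommit \<tau>))
       (propagate \<tau> (dp h) ({#Fwd (C - {\<tau>}) D (HCommit \<tau> s # h) p s'#} + M))"
| roll_commit_delayed:
    "lstep s (LCommit \<tau>) s' \<Longrightarrow> \<not> last_ck \<tau> h \<Longrightarrow>
     roll_step ({#Fwd C D h p s#} + M) (Some (p, ADelay \<tau>))
       ({#Fwd (C - {\<tau>}) (D \<union> {(\<tau>, h, dp h)}) (HCommit \<tau> s # h) p s'#} + M)"
| roll_delay:
    "last_ck \<tau> h' \<Longrightarrow>
     roll_step ({#Fwd C (D \<union> {(\<tau>, h', P)}) h p s#} + M) None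
       (propagate \<tau> P ({#Fwd C D h p s#} + M))"

end


section \<open>Well-defined derivations\<close>

type_synonym ('s, 'p, 'v, 'l, 'c) trans =
  "('s, 'p, 'v, 'l, 'c) sys \<times> ('p, 'l, 'c) rlab \<times> ('s, 'p, 'v, 'l, 'c) sys"

text \<open>A derivation is given by the list of its steps; \<open>derivation S d S'\<close> says that \<open>d\<close> leads from
  \<open>S\<close> to \<open>S'\<close>.\<close>

context local_semantics
begin

primrec derivation ::
    "('s, 'p, 'v, 'l, 'c) sys \<Rightarrow> ('s, 'p, 'v, 'l, 'c) trans list \<Rightarrow> ('s, 'p, 'v, 'l, 'c) sys \<Rightarrow> bool"
where
  "derivation S [] S' \<longleftrightarrow> S' = S"
| "derivation S (t # d) S' \<longleftrightarrow>
     (case t of (S1, a, S2) \<Rightarrow> S1 = S \<and> roll_step S1 a S2 \<and> derivation S2 d S')"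

end

inductive in_history ::
    "'p \<Rightarrow> ('s, 'p, 'v, 'l, 'c) hitem \<Rightarrow> ('s, 'p, 'v, 'l, 'c) sys \<Rightarrow> bool" where
  "Fwd C D h p s \<in># S \<Longrightarrow> i \<in> set h \<Longrightarrow> in_history p i S"
| "Bwd \<tau> C D h p s \<in># S \<Longrightarrow> i \<in> set h \<Longrightarrow> in_history p i S"

text \<open>A process calls commit or rollback in a step labelled \<open>ACommit\<close>, \<open>ADelay\<close> or \<open>ARollback\<close>.
  Such a call for \<open>\<tau>\<close> must be preceded by a check returning \<open>\<tau>\<close>, and it must be the only action of
  the process for \<open>\<tau>\<close>.  Both are meant up to actions that have been undone, that is, removed from
  the history: the check must still be there, and there must be no commit.  (A rollback leaves no
  trace in a history; it removes the check from it.)\<close>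

definition preceded_by_check ::
    "('s, 'p, 'v, 'l, 'c) trans list \<Rightarrow> nat \<Rightarrow> 'p \<Rightarrow> 'c \<Rightarrow> bool" where
  "preceded_by_check d i p \<tau> \<longleftrightarrow> (\<exists>j<i. \<exists>S S'. d ! j = (S, Some (p, ACheck \<tau>), S'))"

definition only_action :: "'p \<Rightarrow> 'c \<Rightarrow> ('s, 'p, 'v, 'l, 'c) sys \<Rightarrow> bool" where
  "only_action p \<tau> S \<longleftrightarrow>
     (\<exists>s. in_history p (HCheck \<tau> s) S) \<and> \<not> (\<exists>s. in_history p (HCommit \<tau> s) S)"

definition disciplined :: "('s, 'p, 'v, 'l, 'c) trans list \<Rightarrow> bool" where
  "disciplined d \<longleftrightarrow>
     (\<forall>i<length d. \<forall>S S' p \<tau> b. d ! i = (S, Some (p, b), S') \<longrightarrow>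
        b \<in> {ACommit \<tau>, ADelay \<tau>, ARollback \<tau>} \<longrightarrow>
        preceded_by_check d i p \<tau> \<and> only_action p \<tau> S)"

text \<open>The first system of \<open>d\<close> is reached by a derivation \<open>e\<close> from an initial system.  The checks
  preceding the calls in \<open>d\<close> may be found in \<open>e\<close>, and the calls in \<open>e\<close> are subject to the same
  conditions.\<close>

definition (in local_semantics) well_defined :: "('s, 'p, 'v, 'l, 'c) trans list \<Rightarrow> bool" where
  "well_defined d \<longleftrightarrow>
     (\<exists>p s e S0 Sn. derivation {#Fwd {} {} [] p s#} e S0 \<and> derivation S0 d Sn \<and>
        disciplined (e @ d))"


section \<open>Projections\<close>

primrec sta_comp :: "('s \<Rightarrow> 's) \<Rightarrow> ('s, 'p, 'v, 'l, 'c) comp \<Rightarrow> ('s, 'p, 'v) scomp" where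
  "sta_comp ovl (Fwd C D h p s) = SProc p (ovl s)"
| "sta_comp ovl (Bwd \<tau> C D h p s) = SProc p (ovl s)"
| "sta_comp ovl (Msg C p q l v) = SMsg p q v"

definition sta :: "('s \<Rightarrow> 's) \<Rightarrow> ('s, 'p, 'v, 'l, 'c) sys \<Rightarrow> ('s, 'p, 'v) scomp multiset" where
  "sta ovl S = image_mset (sta_comp ovl) S"

fun rhist :: "('s, 'p, 'v, 'l, 'c) hist \<Rightarrow> ('s, 'p, 'v, 'l) ritem list" where
  "rhist [] = []"
| "rhist (HSeq s # h) = RSeq s # rhist h"
| "rhist (HSend s p l # h) = RSend s p l # rhist h"
| "rhist (HRec C'' C' s p l v # h) = RRec s p l v # rhist h"
| "rhist (HSpawn s p # h) = RSpawn s p # rhist h"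
| "rhist (HCheck \<tau> s # h) = rhist h"
| "rhist (HCommit \<tau> s # h) = rhist h"

text \<open>The states recorded in a history are overlined like the current state: undoing a step
  reinstates the recorded state, which has to be the overlined one on the reversible side.\<close>

definition ovl_hist ::
    "('s \<Rightarrow> 's) \<Rightarrow> ('s, 'p, 'v, 'l) ritem list \<Rightarrow> ('s, 'p, 'v, 'l) ritem list" where
  "ovl_hist ovl h = map (map_ritem ovl id id id) h"

primrec rev_comp :: "('s \<Rightarrow> 's) \<Rightarrow> ('s, 'p, 'v, 'l, 'c) comp \<Rightarrow> ('s, 'p, 'v, 'l) rcomp" where
  "rev_comp ovl (Fwd C D h p s) = RProc (ovl_hist ovl (rhist h)) p (ovl s)"
| "rev_comp ovl (Bwd \<tau> C D h p s) = RProc (ovl_hist ovl (rhist h)) p (ovl s)"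
| "rev_comp ovl (Msg C p q l v) = RMsg p q l v"

definition rev_sys :: "('s \<Rightarrow> 's) \<Rightarrow> ('s, 'p, 'v, 'l, 'c) sys \<Rightarrow> ('s, 'p, 'v, 'l) rcomp multiset"
where
  "rev_sys ovl S = image_mset (rev_comp ovl) S"

end

theory Submission
  imports Defs
begin

text \<open>Forward steps project to standard steps and backward steps to reversible ones.  The only
  delicate steps are those undoing a check or a commit: the reversible projection does not see them,
  so the recorded state must agree with the current one up to overlining.  This could fail because
  a process without active checkpoints moves without recording its steps.  But a backward process
  moves only while its target is active.  So it suffices that undoing the history leads to
  the empty set of checkpoints wherever unrecorded steps may have taken place (\<open>tight\<close>).  This
  condition survives the loss of checkpoints caused by propagation.  Only a commit enlarges the sets
  obtained by undoing, unless the committed checkpoint is active.  It is, because a check that has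
  not been committed remains active in the process owning it (\<open>owns\<close>): checkpoints are fresh, so
  no other process can commit it.\<close>

section \<open>Undoing a history\<close>

text \<open>This inverts the effect of a recorded step on the active checkpoints, as the backward
  rules do. The first set of a receive record holds only the checkpoints gained, so subtracting it
  is exact.\<close>

primrec undo :: "('s, 'p, 'v, 'l, 'c) hitem \<Rightarrow> 'c set \<Rightarrow> 'c set" where
  "undo (HSeq s) C = C"
| "undo (HSend s p l) C = C"
| "undo (HRec C'' C' s p l v) C = C - C''"
| "undo (HSpawn s p) C = C"
| "undo (HCheck \<tau> s) C = C - {\<tau>}"
| "undo (HCommit \<tau> s) C = insert \<tau> C"

primrec item_state :: "('s, 'p, 'v, 'l, 'c) hitem \<Rightarrow> 's" where
  "item_state (HSeq s) = s"
| "item_state (HSend s p l) = s"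
| "item_state (HRec C'' C' s p l v) = s"
| "item_state (HSpawn s p) = s"
| "item_state (HCheck \<tau> s) = s"
| "item_state (HCommit \<tau> s) = s"

primrec invisible :: "('s, 'p, 'v, 'l, 'c) hitem \<Rightarrow> bool" where
  "invisible (HSeq s) = False"
| "invisible (HSend s p l) = False"
| "invisible (HRec C'' C' s p l v) = False"
| "invisible (HSpawn s p) = False"
| "invisible (HCheck \<tau> s) = True"
| "invisible (HCommit \<tau> s) = True"

text \<open>The escape clause \<open>C = {}\<close> accounts for unrecorded steps: they occur only
  without active checkpoints, and then the process itself can undo nothing. Visible items put no
  condition on the current state, since undoing them reinstates the recorded state in the reversible
  semantics as well.\<close>

primrec tight :: "('s \<Rightarrow> 's) \<Rightarrow> ('s, 'p, 'v, 'l, 'c) hist \<Rightarrow> 'c set \<Rightarrow> 's \<Rightarrow> bool" where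
  "tight ovl [] C s \<longleftrightarrow> True"
| "tight ovl (i # h) C s \<longleftrightarrow> C = {} \<or>
     (invisible i \<longrightarrow> ovl s = ovl (item_state i)) \<and> tight ovl h (undo i C) (item_state i)"

definition checks :: "('s, 'p, 'v, 'l, 'c) hist \<Rightarrow> 'c set" where
  "checks h = {\<tau>. \<exists>s. HCheck \<tau> s \<in> set h}"

definition commits :: "('s, 'p, 'v, 'l, 'c) hist \<Rightarrow> 'c set" where
  "commits h = {\<tau>. \<exists>s. HCommit \<tau> s \<in> set h}"

text \<open>Every suffix is constrained, with the set obtained by undoing up to it, so that the
  condition passes to the shorter history after a backward step.\<close>

primrec owns :: "('s, 'p, 'v, 'l, 'c) hist \<Rightarrow> 'c set \<Rightarrow> bool" where
  "owns [] C \<longleftrightarrow> True"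
| "owns (i # h) C \<longleftrightarrow> checks (i # h) - commits (i # h) \<subseteq> C \<and> owns h (undo i C)"

lemma checks_simps [simp]:
  "checks [] = {}"
  "checks (HSeq s # h) = checks h"
  "checks (HSend s p l # h) = checks h"
  "checks (HRec C'' C' s p l v # h) = checks h"
  "checks (HSpawn s p # h) = checks h"
  "checks (HCheck \<tau> s # h) = insert \<tau> (checks h)"
  "checks (HCommit \<tau> s # h) = checks h"
  by (auto simp: checks_def)

lemma commits_simps [simp]:
  "commits [] = {}"
  "commits (HSeq s # h) = commits h"
  "commits (HSend s p l # h) = commits h"
  "commits (HRec C'' C' s p l v # h) = commits h"
  "commits (HSpawn s p # h) = commits h"
  "commits (HCheck \<tau> s # h) = commits h"
  "commits (HCommit \<tau> s # h) = insert \<tau> (commits h)"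
  by (auto simp: commits_def)

lemma checks_subset_Cons: "checks h \<subseteq> checks (i # h)"
  by (auto simp: checks_def)

lemma checks_subset_hist_ckpts: "checks h \<subseteq> hist_ckpts h"
  by (force simp: checks_def hist_ckpts_def)

lemma tight_empty [simp]: "tight ovl h {} s"
  by (cases h) auto

text \<open>\<open>undo\<close> is monotone, and smaller sets can only make the escape clause of
  \<open>tight\<close> apply earlier.\<close>

lemma tight_mono: "tight ovl h C s \<Longrightarrow> C1 \<subseteq> C \<Longrightarrow> tight ovl h C1 s"
proof (induction h arbitrary: C C1 s)
  case (Cons i h)
  have "undo i C1 \<subseteq> undo i C"
    using Cons.prems(2) by (cases i) auto
  then show ?case
    using Cons by (cases "C1 = {}") auto
qed simp

lemma tight_cong: "tight ovl h C s \<Longrightarrow> ovl s' = ovl s \<Longrightarrow> tight ovl h C s'"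
  by (cases h) auto

lemma owns_pending: "owns h C \<Longrightarrow> checks h - commits h \<subseteq> C"
  by (cases h) auto

text \<open>Losing \<tau> does no harm: no suffix of \<open>h\<close> has a check for \<tau> to
  account for, and \<open>undo\<close> preserves inclusion up to \<tau>.\<close>

lemma owns_mono:
  "owns h C \<Longrightarrow> C - {\<tau>} \<subseteq> C1 \<Longrightarrow> \<tau> \<notin> checks h \<Longrightarrow> owns h C1"
proof (induction h arbitrary: C C1)
  case (Cons i h)
  have "undo i C - {\<tau>} \<subseteq> undo i C1"
    using Cons.prems(2) by (cases i) auto
  moreover have "\<tau> \<notin> checks h"
    using Cons.prems(3) checks_subset_Cons[of h i] by blast
  ultimately have "owns h (undo i C1)"
    using Cons.IH Cons.prems(1) by auto
  then show ?case
    using Cons.prems by auto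
qed simp

section \<open>The invariant\<close>

definition proc_ok ::
    "('s \<Rightarrow> 's) \<Rightarrow> 'c set \<Rightarrow> ('s, 'p, 'v, 'l, 'c) delayed \<Rightarrow> ('s, 'p, 'v, 'l, 'c) hist \<Rightarrow> 's \<Rightarrow> bool"
where
  "proc_ok ovl C D h s \<longleftrightarrow>
     tight ovl h C s \<and> owns h C \<and> (\<forall>(\<tau>, h', P) \<in> D. \<not> last_ck \<tau> h')"

primrec comp_ok :: "('s \<Rightarrow> 's) \<Rightarrow> ('s, 'p, 'v, 'l, 'c) comp \<Rightarrow> bool" where
  "comp_ok ovl (Fwd C D h p s) = proc_ok ovl C D h s"
| "comp_ok ovl (Bwd \<tau> C D h p s) = proc_ok ovl C D h s"
| "comp_ok ovl (Msg C p q l v) = True"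

primrec comp_checks :: "('s, 'p, 'v, 'l, 'c) comp \<Rightarrow> 'c set" where
  "comp_checks (Fwd C D h p s) = checks h"
| "comp_checks (Bwd \<tau> C D h p s) = checks h"
| "comp_checks (Msg C p q l v) = {}"

text \<open>Counting with multiplicity also excludes two equal components. Counts add up under
  parallel composition, which turns the Par cases into arithmetic.\<close>

definition occ :: "('x \<Rightarrow> 'a set) \<Rightarrow> 'x multiset \<Rightarrow> 'a \<Rightarrow> nat" where
  "occ f S a = size {#x \<in># S. a \<in> f x#}"

definition inv_sys :: "('s \<Rightarrow> 's) \<Rightarrow> ('s, 'p, 'v, 'l, 'c) sys \<Rightarrow> bool" where
  "inv_sys ovl S \<longleftrightarrow> (\<forall>x\<in>#S. comp_ok ovl x) \<and>
     (\<forall>p. occ pid S p \<le> 1) \<and> (\<forall>\<tau>. occ comp_checks S \<tau> \<le> 1)"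

lemma occ_empty [simp]: "occ f {#} a = 0"
  by (simp add: occ_def)

lemma occ_add_mset [simp]: "occ f (add_mset x S) a = (if a \<in> f x then 1 else 0) + occ f S a"
  by (simp add: occ_def)

lemma occ_union: "occ f (S + T) a = occ f S a + occ f T a"
  by (simp add: occ_def)

lemma occ_image_mset: "(\<And>x. f (g x) = f x) \<Longrightarrow> occ f (image_mset g S) a = occ f S a"
  by (simp add: occ_def filter_mset_image_mset)

lemma occ_eq_0: "(\<And>x. x \<in># S \<Longrightarrow> a \<notin> f x) \<Longrightarrow> occ f S a = 0"
  by (simp add: occ_def)

lemma occ_eq_0D: "occ f S a = 0 \<Longrightarrow> x \<in># S \<Longrightarrow> a \<notin> f x"
  by (auto simp: occ_def)

lemma comp_checks_subset_ckpts: "x \<in># S \<Longrightarrow> comp_checks x \<subseteq> ckpts S"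
proof -
  assume "x \<in># S"
  moreover have "comp_checks x \<subseteq> comp_ckpts x"
    by (cases x) (auto dest: subsetD[OF checks_subset_hist_ckpts])
  ultimately show ?thesis
    by (auto simp: ckpts_def)
qed

section \<open>Propagation and the standard projection\<close>

lemma pid_drop_ckpt [simp]: "pid (drop_ckpt \<tau> Q x) = pid x"
  by (cases x) auto

lemma comp_checks_drop_ckpt [simp]: "comp_checks (drop_ckpt \<tau> Q x) = comp_checks x"
  by (cases x) auto

lemma sta_comp_drop_ckpt [simp]: "sta_comp ovl (drop_ckpt \<tau> Q x) = sta_comp ovl x"
  by (cases x) auto

lemma spid_sta_comp [simp]: "spid (sta_comp ovl x) = pid x"
  by (cases x) auto

lemma spids_sta: "spids (sta ovl S) = pids S"
  by (simp add: spids_def pids_def sta_def)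

lemma sta_propagate: "sta ovl (propagate \<tau> P S) = sta ovl S"
  by (simp add: sta_def propagate_def multiset.map_comp comp_def)

lemma comp_ok_drop_ckpt:
  assumes "comp_ok ovl x" "\<tau> \<notin> comp_checks x"
  shows "comp_ok ovl (drop_ckpt \<tau> Q x)"
proof (cases x)
  case (Fwd C D h p s)
  have "tight ovl h (C - {\<tau>}) s"
    using assms Fwd tight_mono[of ovl h C s "C - {\<tau>}"] by (auto simp: proc_ok_def)
  moreover have "owns h (C - {\<tau>})"
    using assms Fwd owns_mono[of h C \<tau> "C - {\<tau>}"] by (auto simp: proc_ok_def)
  ultimately show ?thesis
    using assms Fwd by (auto simp: proc_ok_def)
qed (use assms in auto)

text \<open>By uniqueness the history of \<open>p\<close> is the only one with a check for \<tau>,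
  and there \<tau> is already inactive. Every other process may lose \<tau> by
  \<open>comp_ok_drop_ckpt\<close>.\<close>

lemma inv_sys_propagate:
  assumes "inv_sys ovl ({#Fwd C D h p s#} + M)" "\<tau> \<in> checks h" "\<tau> \<notin> C"
  shows "inv_sys ovl (propagate \<tau> P ({#Fwd C D h p s#} + M))"
proof -
  have "occ comp_checks M \<tau> = 0"
    using assms(1,2) by (auto simp: inv_sys_def dest!: spec[of _ \<tau>])
  then have "\<tau> \<notin> comp_checks x" if "x \<in># M" for x
    using that by (rule occ_eq_0D)
  then have "comp_ok ovl (drop_ckpt \<tau> Q x)" if "x \<in># M" for x Q
    using that assms(1) by (auto simp: inv_sys_def intro!: comp_ok_drop_ckpt)
  moreover have "comp_ok ovl (drop_ckpt \<tau> Q (Fwd C D h p s))" for Q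
    using assms(1,3) by (simp add: inv_sys_def)
  ultimately show ?thesis
    using assms(1) unfolding inv_sys_def propagate_def
    by (subst (1 2) occ_image_mset) auto
qed

section \<open>Uniqueness of pids and checks under local steps\<close>

context local_semantics
begin

text \<open>The disjunction is chosen to be stable under Par: in its first case the environment adds
  the same count to both sides, in its second the Par condition makes that count zero.\<close>

lemma roll_local_occ_pid:
  "roll_local S a S' \<Longrightarrow>
   occ pid S' q \<le> occ pid S q \<or> q \<in> pids S' \<and> occ pid S' q \<le> 1"
proof (induction rule: roll_local.induct)
  case (roll_par S1 a S1' S2)
  have "q \<in> pids S1' \<Longrightarrow> occ pid S2 q = 0"
    using roll_par.hyps(2) by (intro occ_eq_0) (auto simp: pids_def)
  moreover have "pids (S1' + S2) = pids S1' \<union> pids S2"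
    by (auto simp: pids_def)
  ultimately show ?case
    using roll_par.IH by (auto simp: occ_union)
qed (auto simp: pids_def)

text \<open>Only a check step raises a count, and its \<tau> is fresh. Freshness refers to
  \<open>ckpts\<close>, which covers all checks in histories, so the Par condition keeps \<tau> out
  of the environment.\<close>

lemma roll_local_occ_checks:
  "roll_local S a S' \<Longrightarrow>
   occ comp_checks S' \<tau> \<le> occ comp_checks S \<tau> \<or>
   \<tau> \<in> ckpts S' - ckpts S \<and> occ comp_checks S' \<tau> \<le> 1"
proof (induction rule: roll_local.induct)
  case (roll_par S1 a S1' S2)
  have "\<tau> \<in> ckpts S1' - ckpts S1 \<Longrightarrow> occ comp_checks S2 \<tau> = 0 \<and> \<tau> \<notin> ckpts S2"
    using roll_par.hyps(4) comp_checks_subset_ckpts[of _ S2] by (auto intro!: occ_eq_0)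
  moreover have "ckpts (S1 + S2) = ckpts S1 \<union> ckpts S2" "ckpts (S1' + S2) = ckpts S1' \<union> ckpts S2"
    by (auto simp: ckpts_def)
  ultimately show ?case
    using roll_par.IH by (auto simp: occ_union)
qed (auto simp: ckpts_def hist_ckpts_def add_def)

end

section \<open>Extending and shortening the history of one process\<close>

lemma proc_ok_undo:
  assumes "proc_ok ovl C D (i # h) s" "C \<noteq> {}" "D' \<subseteq> D" "C' = undo i C" "s' = item_state i"
  shows "proc_ok ovl C' D' h s'"
  \<comment> \<open>Since \<open>C\<close> is nonempty, as it is when the target of a backward
    process is active, the escape clause of \<open>tight\<close> is excluded and its condition on
    the tail is available.\<close>
  using assms unfolding proc_ok_def by auto

text \<open>The new head is visible, so \<open>s'\<close> may be arbitrary. If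
  \<open>C' = {}\<close>, nothing is recorded; then \<open>C = {}\<close> as well and the escape
  clause of \<open>tight\<close> applies.\<close>

lemma proc_ok_add:
  assumes "proc_ok ovl C D h (item_state i)" "undo i C' = C" "\<not> invisible i" "C \<subseteq> C'"
    "checks (i # h) = checks h" "commits (i # h) = commits h"
  shows "proc_ok ovl C' D (add C' i h) s'"
  using assms owns_pending[of h C] unfolding proc_ok_def add_def by auto

text \<open>As \<tau> is not in \<open>C\<close>, undoing the new check gives back exactly
  \<open>C\<close>.\<close>

lemma proc_ok_check:
  assumes "proc_ok ovl C D h s" "ovl s' = ovl s" "\<tau> \<notin> C"
  shows "proc_ok ovl (insert \<tau> C) D (HCheck \<tau> s # h) s'"
  using assms owns_pending[of h C] unfolding proc_ok_def by auto

lemma proc_ok_commit: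
  assumes "proc_ok ovl C D h s" "ovl s' = ovl s" "\<tau> \<in> checks h - commits h"
  shows "proc_ok ovl (C - {\<tau>}) D (HCommit \<tau> s # h) s'"
proof -
  \<comment> \<open>Undoing the new commit yields \<open>insert \<tau> C\<close>. Ownership of the
    pending check makes this equal to \<open>C\<close>, the set for which \<open>tight\<close> is
    known.\<close>
  have "\<tau> \<in> C"
    using assms owns_pending[of h C] by (auto simp: proc_ok_def)
  then have "insert \<tau> C = C"
    by auto
  then show ?thesis
    using assms owns_pending[of h C] unfolding proc_ok_def by auto
qed

text \<open>\<open>only_action\<close> speaks of any history of \<open>p\<close> in the system;
  uniqueness of pids pins it down to \<open>h\<close>.\<close>

lemma only_action_pending:
  assumes "only_action p \<tau> ({#Fwd C D h p s#} + M)" "inv_sys ovl ({#Fwd C D h p s#} + M)"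
  shows "\<tau> \<in> checks h - commits h"
proof -
  have "occ pid M p = 0"
    using assms(2) by (auto simp: inv_sys_def dest!: spec[of _ p])
  then have "p \<notin> pid x" if "x \<in># M" for x
    using that by (rule occ_eq_0D)
  then have "in_history p i ({#Fwd C D h p s#} + M) \<longleftrightarrow> i \<in> set h" for i
    by (fastforce simp: in_history.simps)
  then show ?thesis
    using assms(1) by (auto simp: only_action_def checks_def commits_def)
qed

section \<open>Preservation of the invariant\<close>

context overlining
begin

lemma roll_local_comp_ok:
  "roll_local S a S' \<Longrightarrow> (\<forall>x\<in>#S. comp_ok ovl x) \<Longrightarrow> (\<forall>x\<in>#S'. comp_ok ovl x)"
proof (induction rule: roll_local.induct)
  case (roll_seq s s' C D h p)
  then show ?case by (auto intro!: proc_ok_add)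
next
  case (roll_send s p' v s' l C D h p)
  then show ?case by (auto intro!: proc_ok_add)
next
  case (roll_receive s k cs s' v c C' p' p l C D h)
  \<comment> \<open>Undoing the record leaves \<open>(C \<union> C') - (C' - C) = C\<close>, which
    may be empty even if the receive was recorded.\<close>
  then show ?case by (auto intro!: proc_ok_add[where C = C])
next
  case (roll_spawn s k s0 s' p' p C D h)
  then show ?case by (auto intro!: proc_ok_add) (simp add: proc_ok_def)
next
  case (roll_check s k s' \<tau> C D h p)
  then show ?case by (auto simp: ckpts_def intro!: proc_ok_check ovl_check)
next
  case (roll_rollback s \<tau> s' C D h p)
  then show ?case
    using ovl_rollback[of s \<tau> s'] by (auto simp: proc_ok_def intro: tight_cong)
next
  case (roll_u_receive \<tau> C C' C'' D s p' l v h p s')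
  \<comment> \<open>The process may become forward or stay backward; \<open>comp_ok\<close> treats
    both alike, so one fact serves both branches.\<close>
  then have "proc_ok ovl C D h s"
    by (auto elim!: proc_ok_undo)
  then show ?case by simp
qed (auto elim!: proc_ok_undo)

text \<open>Leaving \<open>D'\<close> open lets immediate commits (\<open>D' = D\<close>) and
  delayed ones share the argument.\<close>

lemma inv_sys_commit:
  assumes "inv_sys ovl ({#Fwd C D h p s#} + M)" "lstep s (LCommit \<tau>) s'"
    and "\<tau> \<in> checks h - commits h"
    and "\<And>\<tau>' h' P. (\<tau>', h', P) \<in> D' - D \<Longrightarrow> \<not> last_ck \<tau>' h'"
  shows "inv_sys ovl ({#Fwd (C - {\<tau>}) D' (HCommit \<tau> s # h) p s'#} + M)"
proof -
  have "proc_ok ovl (C - {\<tau>}) D (HCommit \<tau> s # h) s'"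
    using assms ovl_commit[of s \<tau> s'] by (auto simp: inv_sys_def intro: proc_ok_commit)
  then have "proc_ok ovl (C - {\<tau>}) D' (HCommit \<tau> s # h) s'"
    using assms(4) unfolding proc_ok_def by fast
  then show ?thesis
    using assms(1) by (auto simp: inv_sys_def)
qed

lemma roll_step_inv_sys:
  assumes "roll_step S a S'" and "inv_sys ovl S"
    and only: "\<And>p \<tau>. a \<in> {Some (p, ACommit \<tau>), Some (p, ADelay \<tau>)} \<Longrightarrow> only_action p \<tau> S"
  shows "inv_sys ovl S'"
proof -
  from assms(1) show ?thesis
  proof cases
    case roll_local
    have "occ pid S' q \<le> 1" "occ comp_checks S' \<tau> \<le> 1" for q \<tau>
      using roll_local_occ_pid[OF roll_local, of q] roll_local_occ_checks[OF roll_local, of \<tau>]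
        assms(2) by (auto simp: inv_sys_def intro: order_trans)
    then show ?thesis
      using roll_local_comp_ok[OF roll_local] assms(2) by (simp add: inv_sys_def)
  next
    case (roll_commit s \<tau> s' h C D p M)
    have "only_action p \<tau> S"
      by (rule only) (simp add: roll_commit(2))
    then have "\<tau> \<in> checks h - commits h"
      using assms(2) unfolding roll_commit(1) by (rule only_action_pending)
    \<comment> \<open>After the commit, \<tau> is checked in the history of \<open>p\<close> but
      inactive there, which is what \<open>inv_sys_propagate\<close> asks for.\<close>
    then show ?thesis
      using roll_commit assms(2) inv_sys_commit[of C D h p s M \<tau> s' D]
        inv_sys_propagate[of ovl "C - {\<tau>}" D "HCommit \<tau> s # h" p s' M \<tau> "dp h"]
      by simp
  next
    case (roll_commit_delayed s \<tau> s' h C D p M)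
    have "only_action p \<tau> S"
      by (rule only) (simp add: roll_commit_delayed(2))
    then have "\<tau> \<in> checks h - commits h"
      using assms(2) unfolding roll_commit_delayed(1) by (rule only_action_pending)
    \<comment> \<open>The added entry stores \<open>h\<close> itself, for which
      \<open>last_ck\<close> fails by the premise of the rule.\<close>
    then show ?thesis
      using roll_commit_delayed assms(2)
        inv_sys_commit[of C D h p s M \<tau> s' "D \<union> {(\<tau>, h, dp h)}"]
      by auto
  next
    case (roll_delay \<tau> h' C D P h p s M)
    \<comment> \<open>The history of a delayed commit is fixed when the commit is delayed, so it never
      satisfies \<open>last_ck\<close> and this rule is never enabled.\<close>
    then have False
      using assms(2) by (auto simp: inv_sys_def proc_ok_def)
    then show ?thesis ..
  qed
qed

section \<open>Simulation\<close>

text \<open>Forward steps are matched through \<open>sta\<close>, because an unrecorded step does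
  not extend the history as a forward reversible step must. Backward steps are matched by
  \<open>rev_bwd\<close>, whose Par rule has no freshness condition to transfer through the
  projection.\<close>

lemma roll_local_simulation:
  "roll_local S a S' \<Longrightarrow> (\<forall>x\<in>#S. comp_ok ovl x) \<Longrightarrow>
   std_step\<^sup>=\<^sup>= (sta ovl S) (sta ovl S') \<or> rev_bwd\<^sup>=\<^sup>= (rev_sys ovl S) (rev_sys ovl S')"
proof (induction rule: roll_local.induct)
  case (roll_seq s s' C D h p)
  then show ?case
    using ovl_seq[of s s'] by (auto simp: sta_def intro: std_seq)
next
  case (roll_send s p' v s' l C D h p)
  then show ?case
    using std_send[OF ovl_send] by (simp add: sta_def)
next
  case (roll_receive s k cs s' v c C' p' p l C D h)
  then show ?case
    using std_rec[OF ovl_rec ovl_matchrec] by (simp add: sta_def ovl_bind_clause)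
next
  case (roll_spawn s k s0 s' p' p C D h)
  then show ?case
    using std_spawn[OF ovl_spawn] by (simp add: sta_def ovl_bind_pid)
next
  case (roll_check s k s' \<tau> C D h p)
  then show ?case
    by (simp add: sta_def ovl_check)
next
  case (roll_rollback s \<tau> s' C D h p)
  then show ?case
    by (simp add: sta_def ovl_rollback)
next
  case (roll_u_seq \<tau> C D s h p s')
  show ?case
    by (simp add: rev_sys_def ovl_hist_def rb_seq)
next
  case (roll_u_send1 \<tau> C p p' l v D s h s')
  show ?case
    by (simp add: rev_sys_def ovl_hist_def rb_send)
next
  case (roll_u_receive \<tau> C C' C'' D s p' l v h p s')
  show ?case
    by (simp add: rev_sys_def ovl_hist_def rb_rec)
next
  case (roll_u_spawn1 \<tau> C D s p' h p s' s0)
  show ?case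
    by (simp add: rev_sys_def ovl_hist_def rb_spawn)
next
  case (roll_par S1 a S1' S2)
  have "std_step (sta ovl S1) (sta ovl S1') \<Longrightarrow>
      std_step (sta ovl S1 + sta ovl S2) (sta ovl S1' + sta ovl S2)"
    using roll_par.hyps(2) by (intro std_par) (simp_all add: spids_sta)
  moreover have "rev_bwd (rev_sys ovl S1) (rev_sys ovl S1') \<Longrightarrow>
      rev_bwd (rev_sys ovl S1 + rev_sys ovl S2) (rev_sys ovl S1' + rev_sys ovl S2)"
    by (rule rb_par)
  ultimately show ?case
    using roll_par.IH roll_par.prems by (auto simp: sta_def rev_sys_def)
\<comment> \<open>The remaining rules leave both projections unchanged. Two of them only turn a
  process backward; the others undo a check or a commit, where the active target makes the set
  nonempty and \<open>tight\<close> equates the two overlined states.\<close>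
qed (auto simp: sta_def rev_sys_def proc_ok_def)

lemma roll_step_simulation:
  assumes "roll_step S a S'" "inv_sys ovl S"
  shows "std_step\<^sup>=\<^sup>= (sta ovl S) (sta ovl S') \<or> rev_step\<^sup>=\<^sup>= (rev_sys ovl S) (rev_sys ovl S')"
  using assms(1)
proof cases
  case roll_local
  then show ?thesis
    using roll_local_simulation[of S a S'] assms(2) by (auto simp: inv_sys_def rev_step_def)
\<comment> \<open>Standard systems carry neither checkpoint sets nor delayed commits, so commits,
  delayed commits and propagation all leave \<open>sta\<close> fixed.\<close>
qed (simp_all only: sta_propagate, simp_all add: sta_def ovl_commit)

section \<open>From single steps to derivations\<close>

lemma derivation_append:
  "derivation S (d1 @ d2) S2 \<longleftrightarrow> (\<exists>S1. derivation S d1 S1 \<and> derivation S1 d2 S2)"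
  by (induction d1 arbitrary: S) auto

text \<open>Each step preserves the invariant, so it reaches the source of every step of
  \<open>d\<close>. Speaking of members of \<open>d\<close> instead of positions lets the discipline
  hypothesis pass to the tail in the induction.\<close>

lemma derivation_inv_sys:
  assumes "derivation S d Sn" "inv_sys ovl S"
    and "\<And>S1 p b S2 \<tau>. (S1, Some (p, b), S2) \<in> set d \<Longrightarrow> b \<in> {ACommit \<tau>, ADelay \<tau>} \<Longrightarrow>
      only_action p \<tau> S1"
    and "(S1, a, S2) \<in> set d"
  shows "inv_sys ovl S1 \<and> roll_step S1 a S2"
  using assms
proof (induction d arbitrary: S)
  case (Cons t d)
  obtain b T where t: "t = (S, b, T)" and step: "roll_step S b T" and d: "derivation T d Sn"
    using Cons.prems(1) by (cases t) auto
  have only: "only_action p \<tau> S"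
    if "b \<in> {Some (p, ACommit \<tau>), Some (p, ADelay \<tau>)}" for p \<tau>
    using that Cons.prems(3)[of S p _ T \<tau>] t by auto
  have "inv_sys ovl T"
    by (rule roll_step_inv_sys[OF step Cons.prems(2) only])
  moreover have "only_action p \<tau> T1"
    if "(T1, Some (p, b), T2) \<in> set d" "b \<in> {ACommit \<tau>, ADelay \<tau>}" for T1 p b T2 \<tau>
    using that Cons.prems(3)[of T1 p b T2 \<tau>] by simp
  ultimately have "(S1, a, S2) \<in> set d \<Longrightarrow> ?case"
    by (rule Cons.IH[OF d])
  then show ?case
    using Cons.prems(2,4) t step by auto
qed simp

end

theorem theorem1:
  fixes lstep :: "'s \<Rightarrow> ('s, 'p, 'v, 'c, 'k, 'cl) lab \<Rightarrow> 's \<Rightarrow> bool"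
    and bind :: "'s \<Rightarrow> 'k \<Rightarrow> ('p, 'c, 'cl) bval \<Rightarrow> 's"
    and matchrec :: "'cl list \<Rightarrow> 'v \<Rightarrow> 'cl option"
    and ovl :: "'s \<Rightarrow> 's"
    and ovlc :: "'cl \<Rightarrow> 'cl"
    and d :: "('s, 'p, 'v, 'l, 'c) trans list"
    and S S' :: "('s, 'p, 'v, 'l, 'c) sys"
    and a :: "('p, 'l, 'c) rlab"
  assumes "overlining lstep bind matchrec ovl ovlc"
    and "local_semantics.well_defined lstep bind matchrec d"
    and "(S, a, S') \<in> set d"
  shows "(local_semantics.std_step lstep bind matchrec)\<^sup>=\<^sup>= (sta ovl S) (sta ovl S') \<or>
         (local_semantics.rev_step lstep bind matchrec)\<^sup>=\<^sup>= (rev_sys ovl S) (rev_sys ovl S')"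
proof -
  interpret overlining lstep bind matchrec ovl ovlc
    by fact
  obtain p s e S0 Sn where "derivation {#Fwd {} {} [] p s#} e S0" "derivation S0 d Sn"
    and disc: "disciplined (e @ d)"
    using assms(2) unfolding well_defined_def by blast
  \<comment> \<open>The invariant is evident only at the initial system, with its empty history, so
    the derivation leading to \<open>S0\<close> is prepended; \<open>disciplined\<close> constrains
    both together.\<close>
  then have "derivation {#Fwd {} {} [] p s#} (e @ d) Sn"
    by (auto simp: derivation_append)
  moreover have "inv_sys ovl {#Fwd {} {} [] p s#}"
    by (simp add: inv_sys_def proc_ok_def)
  moreover have "only_action q \<tau> S1"
    if "(S1, Some (q, b), S2) \<in> set (e @ d)" "b \<in> {ACommit \<tau>, ADelay \<tau>}" for S1 q b S2 \<tau>
  proof -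
    obtain i where "i < length (e @ d)" "(e @ d) ! i = (S1, Some (q, b), S2)"
      using \<open>(S1, Some (q, b), S2) \<in> set (e @ d)\<close> by (auto simp only: in_set_conv_nth)
    then show ?thesis
      using disc that(2) unfolding disciplined_def by blast
  qed
  moreover have "(S, a, S') \<in> set (e @ d)"
    using assms(3) by simp
  ultimately have "inv_sys ovl S \<and> roll_step S a S'"
    by (rule derivation_inv_sys)
  then show ?thesis
    using roll_step_simulation by blast
qed

end
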